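(* Let $G$ be a group and let $R$ be a $G$-graded ring such that every proper graded ideal of $R$ is a graded weakly prime ideal of $R$ and $R^2=R$. Then $R$ has at most two graded maximal ideals.
   Context: Rings are associative, not necessarily commutative and not necessarily with unity; ideals are two-sided. A ring $R$ is $G$-graded if $R=\bigoplus_{g\in G}R_g$ with additive subgroups $R_g$ satisfying $R_gR_h\subseteq R_{gh}$ for all $g,h\in G$. An ideal $I$ of $R$ is graded if $I=\bigoplus_{g\in G}(I\cap R_g)$. The product $IJ$ of ideals is the additive subgroup of all finite sums of products $xy$ with $x\in I$, $y\in J$; in particular $R^2=RR$. A proper graded ideal $P$ of $R$ is a graded weakly prime ideal of $R$ if whenever $I,J$ are graded ideals of $R$ with $0\neq IJ\subseteq P$, then $I\subseteq P$ or $J\subseteq P$. A graded maximal ideal is a proper graded ideal that is maximal (under inclusion) among proper graded ideals of $R$. *)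

theory Defs
  imports Main
begin

text \<open>
  Rings are types of class \<open>ring\<close>: associative, not necessarily commutative, not necessarily unital.
  Groups are types of class \<open>group_add\<close>: the operation is written \<open>+\<close> but need not be commutative,
  so that \<open>g + h\<close> is the product \<open>gh\<close>.
\<close>

definition additive_subgroup :: "'a::ab_group_add set \<Rightarrow> bool" where
  "additive_subgroup A \<longleftrightarrow> 0 \<in> A \<and> (\<forall>x\<in>A. \<forall>y\<in>A. x + y \<in> A) \<and> (\<forall>x\<in>A. - x \<in> A)"

text \<open>The elements of the external direct sum of a family of additive subgroups.\<close>

definition finsupp_families :: "('g \<Rightarrow> 'a::ab_group_add set) \<Rightarrow> ('g \<Rightarrow> 'a) set" where
  "finsupp_families A = {f. (\<forall>g. f g \<in> A g) \<and> finite {g. f g \<noteq> 0}}"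

text \<open>\<open>S\<close> is the internal direct sum of the \<open>A g\<close>: the summation map from the external direct sum
  is a bijection onto \<open>S\<close>.\<close>

definition is_direct_sum :: "'a::ab_group_add set \<Rightarrow> ('g \<Rightarrow> 'a set) \<Rightarrow> bool" where
  "is_direct_sum S A \<longleftrightarrow>
     (\<forall>g. additive_subgroup (A g)) \<and>
     bij_betw (\<lambda>f. \<Sum>g | f g \<noteq> 0. f g) (finsupp_families A) S"

definition grading :: "('g::group_add \<Rightarrow> 'a::ring set) \<Rightarrow> bool" where
  "grading A \<longleftrightarrow>
     is_direct_sum UNIV A \<and> (\<forall>g h. \<forall>x\<in>A g. \<forall>y\<in>A h. x * y \<in> A (g + h))"

definition two_sided_ideal :: "'a::ring set \<Rightarrow> bool" where
  "two_sided_ideal I \<longleftrightarrow>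
     additive_subgroup I \<and> (\<forall>x\<in>I. \<forall>r. r * x \<in> I \<and> x * r \<in> I)"

definition graded_ideal :: "('g::group_add \<Rightarrow> 'a::ring set) \<Rightarrow> 'a set \<Rightarrow> bool" where
  "graded_ideal A I \<longleftrightarrow> two_sided_ideal I \<and> is_direct_sum I (\<lambda>g. I \<inter> A g)"

definition proper_graded_ideal :: "('g::group_add \<Rightarrow> 'a::ring set) \<Rightarrow> 'a set \<Rightarrow> bool" where
  "proper_graded_ideal A I \<longleftrightarrow> graded_ideal A I \<and> I \<noteq> UNIV"

definition ideal_product :: "'a::ring set \<Rightarrow> 'a set \<Rightarrow> 'a set" where
  "ideal_product I J =
     {\<Sum>i<n. x i * y i | (n::nat) x y. \<forall>i<n. x i \<in> I \<and> y i \<in> J}"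

definition graded_weakly_prime :: "('g::group_add \<Rightarrow> 'a::ring set) \<Rightarrow> 'a set \<Rightarrow> bool" where
  "graded_weakly_prime A P \<longleftrightarrow>
     proper_graded_ideal A P \<and>
     (\<forall>I J. graded_ideal A I \<longrightarrow> graded_ideal A J \<longrightarrow>
        ideal_product I J \<noteq> {0} \<longrightarrow> ideal_product I J \<subseteq> P \<longrightarrow> I \<subseteq> P \<or> J \<subseteq> P)"

definition graded_maximal :: "('g::group_add \<Rightarrow> 'a::ring set) \<Rightarrow> 'a set \<Rightarrow> bool" where
  "graded_maximal A M \<longleftrightarrow>
     proper_graded_ideal A M \<and>
     (\<forall>I. proper_graded_ideal A I \<longrightarrow> M \<subseteq> I \<longrightarrow> I = M)"

end

theory Submission
  imports Defs
begin

text \<open>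
  Distinct graded maximal ideals \<open>M\<close> and \<open>N\<close> satisfy \<open>M N = 0\<close>: otherwise weak primeness of
  \<open>M \<inter> N\<close>, which contains \<open>M N\<close>, makes \<open>M\<close> and \<open>N\<close> comparable and hence equal. Moreover
  \<open>M + N = R\<close>. With three of them,
  \<open>R = R\<^sup>2 = (L + M) (L + N) = L\<^sup>2 + L N + M L + M N = L\<^sup>2 \<subseteq> L\<close>, a contradiction.
\<close>

lemma additive_subgroup_sum:
  assumes "additive_subgroup S" "\<And>i. i \<in> I \<Longrightarrow> f i \<in> S"
  shows "sum f I \<in> S"
  using assms
  by (induction I rule: infinite_finite_induct) (auto simp: additive_subgroup_def)

lemma additive_subgroup_Int:
  "additive_subgroup S \<Longrightarrow> additive_subgroup T \<Longrightarrow> additive_subgroup (S \<inter> T)"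
  by (auto simp: additive_subgroup_def)

lemma finsupp_families_mono:
  "(\<And>g. A g \<subseteq> B g) \<Longrightarrow> finsupp_families A \<subseteq> finsupp_families B"
  by (auto simp: finsupp_families_def)

lemma grading_additive_subgroup: "grading A \<Longrightarrow> additive_subgroup (A g)"
  by (simp add: grading_def is_direct_sum_def)

text \<open>This is the uniqueness of homogeneous components in the whole ring, from which
  uniqueness inside every ideal is derived.\<close>

lemma grading_inj_on:
  "grading A \<Longrightarrow> inj_on (\<lambda>f. \<Sum>g | f g \<noteq> 0. f g) (finsupp_families A)"
  by (simp add: grading_def is_direct_sum_def bij_betw_def)

text \<open>Only existence of a decomposition has to be checked: a family with values in the sets
  \<open>I \<inter> A g\<close> is also a family for \<open>A\<close>, so uniqueness is inherited
  from the grading, and its sum stays in \<open>I\<close> because \<open>I\<close> is closed under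
  addition.\<close>

lemma graded_idealI:
  assumes A: "grading A" and I: "two_sided_ideal I"
    and decomp: "\<And>x. x \<in> I \<Longrightarrow>
      \<exists>f \<in> finsupp_families (\<lambda>g. I \<inter> A g). x = (\<Sum>g | f g \<noteq> 0. f g)"
  shows "graded_ideal A I"
proof -
  have sub: "additive_subgroup I"
    using I by (simp add: two_sided_ideal_def)
  have "inj_on (\<lambda>f. \<Sum>g | f g \<noteq> 0. f g) (finsupp_families (\<lambda>g. I \<inter> A g))"
    by (rule inj_on_subset[OF grading_inj_on[OF A] finsupp_families_mono]) auto
  moreover have "(\<lambda>f. \<Sum>g | f g \<noteq> 0. f g) ` finsupp_families (\<lambda>g. I \<inter> A g) = I"
  proof (intro equalityI image_subsetI subsetI)
    fix f assume "f \<in> finsupp_families (\<lambda>g. I \<inter> A g)"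
    then show "(\<Sum>g | f g \<noteq> 0. f g) \<in> I"
      by (intro additive_subgroup_sum[OF sub]) (auto simp: finsupp_families_def)
  next
    fix x assume "x \<in> I"
    then show "x \<in> (\<lambda>f. \<Sum>g | f g \<noteq> 0. f g) ` finsupp_families (\<lambda>g. I \<inter> A g)"
      using decomp by blast
  qed
  ultimately show ?thesis
    using I additive_subgroup_Int[OF sub grading_additive_subgroup[OF A]]
    by (auto simp: graded_ideal_def is_direct_sum_def bij_betw_def)
qed

lemma graded_ideal_decomp:
  assumes "graded_ideal A I" "x \<in> I"
  obtains f where "f \<in> finsupp_families (\<lambda>g. I \<inter> A g)" "x = (\<Sum>g | f g \<noteq> 0. f g)"
proof -
  have "x \<in> (\<lambda>f. \<Sum>g | f g \<noteq> 0. f g) ` finsupp_families (\<lambda>g. I \<inter> A g)"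
    using assms by (simp add: graded_ideal_def is_direct_sum_def bij_betw_def)
  then show thesis
    using that by blast
qed

text \<open>An element of both ideals has one decomposition with components in \<open>I\<close> and
  one with components in \<open>J\<close>. Uniqueness in the ring identifies the two, so the
  components lie in both ideals.\<close>

lemma graded_ideal_Int:
  assumes A: "grading A" and I: "graded_ideal A I" and J: "graded_ideal A J"
  shows "graded_ideal A (I \<inter> J)"
proof (rule graded_idealI[OF A])
  show "two_sided_ideal (I \<inter> J)"
    using I J by (auto simp: graded_ideal_def two_sided_ideal_def intro: additive_subgroup_Int)
next
  fix x assume x: "x \<in> I \<inter> J"
  obtain f where f: "f \<in> finsupp_families (\<lambda>g. I \<inter> A g)" "x = (\<Sum>g | f g \<noteq> 0. f g)"
    using graded_ideal_decomp[OF I] x by blast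
  obtain h where h: "h \<in> finsupp_families (\<lambda>g. J \<inter> A g)" "x = (\<Sum>g | h g \<noteq> 0. h g)"
    using graded_ideal_decomp[OF J] x by blast
  have "f \<in> finsupp_families A" "h \<in> finsupp_families A"
    using f(1) h(1) by (auto simp: finsupp_families_def)
  then have "f = h"
    using f(2) h(2) by (intro inj_onD[OF grading_inj_on[OF A]]) auto
  then have "f \<in> finsupp_families (\<lambda>g. (I \<inter> J) \<inter> A g)"
    using f(1) h(1) by (auto simp: finsupp_families_def)
  then show "\<exists>f \<in> finsupp_families (\<lambda>g. (I \<inter> J) \<inter> A g). x = (\<Sum>g | f g \<noteq> 0. f g)"
    using f(2) by blast
qed

lemma two_sided_ideal_add:
  assumes I: "two_sided_ideal I" and J: "two_sided_ideal J"
  shows "two_sided_ideal {a + b | a b. a \<in> I \<and> b \<in> J}" (is "two_sided_ideal ?S")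
  unfolding two_sided_ideal_def additive_subgroup_def
proof (intro conjI ballI allI)
  show "0 \<in> ?S"
    using I J by (auto simp: two_sided_ideal_def additive_subgroup_def intro!: exI[of _ 0])
next
  fix x y assume "x \<in> ?S" "y \<in> ?S"
  then obtain a b c d where *: "x = a + b" "y = c + d" "a \<in> I" "b \<in> J" "c \<in> I" "d \<in> J"
    by blast
  then have "x + y = (a + c) + (b + d)" "a + c \<in> I" "b + d \<in> J"
    using I J by (auto simp: two_sided_ideal_def additive_subgroup_def algebra_simps)
  then show "x + y \<in> ?S" by blast
next
  fix x assume "x \<in> ?S"
  then obtain a b where *: "x = a + b" "a \<in> I" "b \<in> J" by blast
  then have "- x = (- a) + (- b)" "- a \<in> I" "- b \<in> J"
    using I J by (auto simp: two_sided_ideal_def additive_subgroup_def)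
  then show "- x \<in> ?S" by blast
next
  fix x r assume "x \<in> ?S"
  then obtain a b where *: "x = a + b" "a \<in> I" "b \<in> J" by blast
  then have "r * x = r * a + r * b" "r * a \<in> I" "r * b \<in> J"
    and "x * r = a * r + b * r" "a * r \<in> I" "b * r \<in> J"
    using I J by (auto simp: two_sided_ideal_def algebra_simps)
  then show "r * x \<in> ?S" "x * r \<in> ?S" by blast+
qed

text \<open>Decompositions of the two summands are added degree by degree.\<close>

lemma graded_ideal_add:
  assumes A: "grading A" and I: "graded_ideal A I" and J: "graded_ideal A J"
  shows "graded_ideal A {a + b | a b. a \<in> I \<and> b \<in> J}" (is "graded_ideal A ?S")
proof (rule graded_idealI[OF A])
  show "two_sided_ideal ?S"
    using I J by (auto simp: graded_ideal_def intro: two_sided_ideal_add)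
next
  fix x assume "x \<in> ?S"
  then obtain a b where x: "x = a + b" "a \<in> I" "b \<in> J" by blast
  obtain f where f: "f \<in> finsupp_families (\<lambda>g. I \<inter> A g)" "a = (\<Sum>g | f g \<noteq> 0. f g)"
    using graded_ideal_decomp[OF I x(2)] by blast
  obtain h where h: "h \<in> finsupp_families (\<lambda>g. J \<inter> A g)" "b = (\<Sum>g | h g \<noteq> 0. h g)"
    using graded_ideal_decomp[OF J x(3)] by blast
  define k where "k g = f g + h g" for g
  \<comment> \<open>Components may cancel, so the support of \<open>k\<close> can be smaller than
    the union of the supports of \<open>f\<close> and \<open>h\<close>. All three sums are therefore
    extended by zeros to the common finite set \<open>U\<close>, where they can be added
    termwise.\<close>
  define U where "U = {g. f g \<noteq> 0} \<union> {g. h g \<noteq> 0}"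
  have U: "finite U" "{g. k g \<noteq> 0} \<subseteq> U"
    using f(1) h(1) by (auto simp: U_def k_def finsupp_families_def)
  have "k g \<in> ?S \<inter> A g" for g
    using f(1) h(1) grading_additive_subgroup[OF A, of g]
    by (auto simp: k_def finsupp_families_def additive_subgroup_def)
  then have "k \<in> finsupp_families (\<lambda>g. ?S \<inter> A g)"
    using U by (auto simp: finsupp_families_def intro: finite_subset)
  moreover have "x = (\<Sum>g | k g \<noteq> 0. k g)"
  proof -
    have "a = sum f U" "b = sum h U" "(\<Sum>g | k g \<noteq> 0. k g) = sum k U"
      unfolding f(2) h(2) using U by (auto simp: U_def intro!: sum.mono_neutral_left)
    then show ?thesis
      by (simp add: x(1) k_def sum.distrib)
  qed
  ultimately show "\<exists>k \<in> finsupp_families (\<lambda>g. ?S \<inter> A g). x = (\<Sum>g | k g \<noteq> 0. k g)"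
    by blast
qed

lemma graded_maximal_comparable:
  "graded_maximal A M \<Longrightarrow> graded_maximal A N \<Longrightarrow> M \<subseteq> N \<Longrightarrow> M = N"
  by (auto simp: graded_maximal_def)

text \<open>The sum \<open>M + N\<close> is a graded ideal above both. Were it proper, maximality of
  \<open>M\<close> would make it equal to \<open>M\<close>, so \<open>N \<subseteq> M\<close>, and
  maximality of \<open>N\<close> would force equality.\<close>

lemma graded_maximal_add:
  assumes A: "grading A" and M: "graded_maximal A M" and N: "graded_maximal A N"
    and "M \<noteq> N"
  obtains a b where "a \<in> M" "b \<in> N" "x = a + b"
proof -
  let ?S = "{a + b | a b. a \<in> M \<and> b \<in> N}"
  have gr: "graded_ideal A M" "graded_ideal A N"
    using M N by (auto simp: graded_maximal_def proper_graded_ideal_def)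
  then have zero: "0 \<in> M" "0 \<in> N"
    by (auto simp: graded_ideal_def two_sided_ideal_def additive_subgroup_def)
  have "M \<subseteq> ?S"
    using zero(2) by force
  have "N \<subseteq> ?S"
    using zero(1) by force
  have "?S = UNIV"
  proof (rule ccontr)
    assume "?S \<noteq> UNIV"
    then have "proper_graded_ideal A ?S"
      using graded_ideal_add[OF A gr] by (simp add: proper_graded_ideal_def)
    then have "?S = M"
      using M \<open>M \<subseteq> ?S\<close> by (simp add: graded_maximal_def)
    then show False
      using graded_maximal_comparable[OF N M] \<open>N \<subseteq> ?S\<close> \<open>M \<noteq> N\<close> by simp
  qed
  then have "x \<in> ?S" by simp
  then show thesis using that by blast
qed

lemma mult_mem_ideal_product:
  assumes "x \<in> I" "y \<in> J"
  shows "x * y \<in> ideal_product I J"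
proof -
  have "x * y = (\<Sum>i<1::nat. x * y)" by simp
  then show ?thesis
    unfolding ideal_product_def using assms
    by (intro CollectI exI[of _ 1] exI[of _ "\<lambda>_. x"] exI[of _ "\<lambda>_. y"]) auto
qed

text \<open>Elements of the product are finite sums, so closure under addition reduces the inclusion
  to single products.\<close>

lemma ideal_product_subset:
  assumes "additive_subgroup S" "\<And>x y. x \<in> I \<Longrightarrow> y \<in> J \<Longrightarrow> x * y \<in> S"
  shows "ideal_product I J \<subseteq> S"
  unfolding ideal_product_def using assms by (auto intro!: additive_subgroup_sum)

lemma graded_maximal_mult_eq_0:
  assumes A: "grading A"
    and wp: "\<And>P. proper_graded_ideal A P \<Longrightarrow> graded_weakly_prime A P"
    and M: "graded_maximal A M" and N: "graded_maximal A N" and "M \<noteq> N"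
    and xy: "x \<in> M" "y \<in> N"
  shows "x * y = 0"
proof (rule ccontr)
  assume "x * y \<noteq> 0"
  \<comment> \<open>Weak primeness speaks only about nonzero products of ideals; the assumed nonzero
    \<open>x * y\<close> provides this.\<close>
  then have nz: "ideal_product M N \<noteq> {0}"
    using mult_mem_ideal_product[OF xy] by auto
  have gr: "graded_ideal A M" "graded_ideal A N" "M \<noteq> UNIV"
    using M N by (auto simp: graded_maximal_def proper_graded_ideal_def)
  have gi: "graded_ideal A (M \<inter> N)"
    by (rule graded_ideal_Int[OF A gr(1,2)])
  have "graded_weakly_prime A (M \<inter> N)"
    using gi gr(3) by (intro wp) (auto simp: proper_graded_ideal_def)
  moreover have "ideal_product M N \<subseteq> M \<inter> N"
    using gr gi by (intro ideal_product_subset) (auto simp: graded_ideal_def two_sided_ideal_def)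
  ultimately have "M \<subseteq> M \<inter> N \<or> N \<subseteq> M \<inter> N"
    using gr nz by (auto simp: graded_weakly_prime_def)
  then show False
    using graded_maximal_comparable[OF M N] graded_maximal_comparable[OF N M] \<open>M \<noteq> N\<close> by blast
qed

lemma no_three_graded_maximal:
  fixes A :: "'g::group_add \<Rightarrow> 'r::ring set"
  assumes A: "grading A"
    and wp: "\<And>P. proper_graded_ideal A P \<Longrightarrow> graded_weakly_prime A P"
    and idem: "ideal_product (UNIV :: 'r set) UNIV = UNIV"
    and L: "graded_maximal A L" and M: "graded_maximal A M" and N: "graded_maximal A N"
    and ne: "L \<noteq> M" "L \<noteq> N" "M \<noteq> N"
  shows False
proof -
  have L': "two_sided_ideal L" "L \<noteq> UNIV"
    using L by (auto simp: graded_maximal_def proper_graded_ideal_def graded_ideal_def)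
  have "x * y \<in> L" for x y
  proof -
    \<comment> \<open>The left factor is split along \<open>L + M\<close> and the right one along
      \<open>L + N\<close>, so that of the four cross products only \<open>a * c\<close> has both
      factors taken from the same maximal ideal.\<close>
    obtain a b where x: "a \<in> L" "b \<in> M" "x = a + b"
      using graded_maximal_add[OF A L M ne(1)] by blast
    obtain c d where y: "c \<in> L" "d \<in> N" "y = c + d"
      using graded_maximal_add[OF A L N ne(2)] by blast
    \<comment> \<open>As the ring need not be commutative, the order of the factors matters: these
      are products from \<open>L N\<close>, \<open>M L\<close> and \<open>M N\<close>.\<close>
    have "a * d = 0" "b * c = 0" "b * d = 0"
      using graded_maximal_mult_eq_0[OF A wp L N ne(2) x(1) y(2)]
        graded_maximal_mult_eq_0[OF A wp M L ne(1)[symmetric] x(2) y(1)]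
        graded_maximal_mult_eq_0[OF A wp M N ne(3) x(2) y(2)] by auto
    then have "x * y = a * c"
      by (simp add: x(3) y(3) algebra_simps)
    then show ?thesis
      using L'(1) x(1) by (simp add: two_sided_ideal_def)
  qed
  then have "ideal_product UNIV UNIV \<subseteq> L"
    using L'(1) by (intro ideal_product_subset) (auto simp: two_sided_ideal_def)
  then show False
    using idem L'(2) by auto
qed

theorem proposition2p9:
  fixes A :: "'g::group_add \<Rightarrow> 'r::ring set"
  assumes "grading A"
    and "\<And>P. proper_graded_ideal A P \<Longrightarrow> graded_weakly_prime A P"
    and "ideal_product (UNIV :: 'r set) UNIV = UNIV"
  shows "finite {M. graded_maximal A M} \<and> card {M. graded_maximal A M} \<le> 2"
proof (rule ccontr)
  let ?X = "{M. graded_maximal A M}"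
  assume "\<not> (finite ?X \<and> card ?X \<le> 2)"
  \<comment> \<open>Since \<open>card\<close> is 0 on infinite sets, the infinite case is kept
    apart; both cases yield a subset with exactly three elements.\<close>
  then have "infinite ?X \<or> 3 \<le> card ?X" by auto
  then obtain T where "T \<subseteq> ?X" "card T = 3"
    using infinite_arbitrarily_large[of ?X 3] obtain_subset_with_card_n[of 3 ?X] by blast
  then obtain L M N where "graded_maximal A L" "graded_maximal A M" "graded_maximal A N"
    and "L \<noteq> M" "L \<noteq> N" "M \<noteq> N"
    by (auto simp: card_3_iff)
  then show False
    \<comment> \<open>\<open>rotated\<close> moves the open weak primeness premise to the end, so
      that the chained facts meet the premises on \<open>L\<close>, \<open>M\<close> and
      \<open>N\<close> first.\<close>
    by (rule no_three_graded_maximal[OF assms(1) _ assms(3), rotated]) (rule assms(2))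
qed

end
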